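(* Let $\mathbb F_q$ be the finite field with $q=p^k$ elements ($p$ prime) and let $S\subseteq \mathbb F_q$ be an $\mathbb F_p$-vector subspace of dimension $r>0$. For a positive integer $n$, let $C_S(n)$ denote the set of monic irreducible polynomials $f\in\mathbb F_q[x]$ of degree $n$ such that $f(x+s)=f(x)$ for all $s\in S$. Then: (a) if $r>1$, then $|C_S(n)|=0$ for all $n$; (b) if $r=1$ and $p\nmid n$, then $|C_S(n)|=0$; (c) if $r=1$ and $n=pm$ with $m$ a positive integer, then $$|C_S(n)|=\frac{p-1}{pm}\sum_{d\mid m,\ \gcd(d,p)=1}q^{m/d}\mu(d),$$ where $\mu$ is the Möbius function.
   Context: A polynomial $f\in\mathbb F_q[x]$ is called $S$-translation invariant if $f(x+s)=f(x)$ for all $s\in S$. *)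

theory Defs
  imports
    Complex_Main
    "HOL-Computational_Algebra.Computational_Algebra"
    "HOL-Computational_Algebra.Squarefree"
    "Berlekamp_Zassenhaus.Finite_Field"
begin

text \<open>
  For a field type \<open>'a\<close> of prime characteristic \<open>p\<close>, the type \<open>'a ring_char\<close> has exactly
  \<open>p\<close> elements, so \<open>'a ring_char mod_ring\<close> is the field of integers modulo \<open>p\<close>. It acts on
  \<open>'a\<close> by multiplication with the image of an integer representative, which makes \<open>'a\<close> a
  vector space over its prime field.
\<close>
definition Fp_scale :: "'a::finite_field ring_char mod_ring \<Rightarrow> 'a \<Rightarrow> 'a" where
  "Fp_scale c x = of_int (to_int_mod_ring c) * x"

global_interpretation Fp: vector_space "Fp_scale :: 'a::finite_field ring_char mod_ring \<Rightarrow> 'a \<Rightarrow> 'a"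
proof
  have mod_CHAR: "of_int (z mod int CARD('a ring_char)) = (of_int z :: 'a)" for z
    by simp
  fix c d :: "'a ring_char mod_ring" and x y :: 'a
  show "Fp_scale c (x + y) = Fp_scale c x + Fp_scale c y"
    by (simp add: Fp_scale_def algebra_simps)
  show "Fp_scale (c + d) x = Fp_scale c x + Fp_scale d x"
    unfolding Fp_scale_def to_int_mod_ring_add mod_CHAR by (simp add: algebra_simps)
  show "Fp_scale c (Fp_scale d x) = Fp_scale (c * d) x"
    unfolding Fp_scale_def to_int_mod_ring_mult mod_CHAR by simp
  have "to_int_mod_ring (1 :: 'a ring_char mod_ring) = 1"
    by transfer simp
  then show "Fp_scale 1 x = x"
    by (simp add: Fp_scale_def)
qed

definition translation_invariant :: "'a::comm_ring_1 set \<Rightarrow> 'a poly \<Rightarrow> bool" where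
  "translation_invariant S f \<longleftrightarrow> (\<forall>s\<in>S. pcompose f [:s, 1:] = f)"

definition invariant_irreducibles :: "'a::field set \<Rightarrow> nat \<Rightarrow> 'a poly set" where
  "invariant_irreducibles S n =
     {f. lead_coeff f = 1 \<and> irreducible f \<and> degree f = n \<and> translation_invariant S f}"

lemma finite_invariant_irreducibles:
  fixes S :: "'a::finite_field set"
  shows "finite (invariant_irreducibles S n)"
proof (rule finite_subset)
  show "invariant_irreducibles S n \<subseteq> Poly ` {xs. set xs \<subseteq> UNIV \<and> length xs \<le> Suc n}"
  proof
    fix f :: "'a poly" assume "f \<in> invariant_irreducibles S n"
    then have "length (coeffs f) \<le> Suc n"
      by (auto simp: invariant_irreducibles_def length_coeffs_degree)
    then show "f \<in> Poly ` {xs. set xs \<subseteq> UNIV \<and> length xs \<le> Suc n}"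
      by (intro image_eqI[of _ _ "coeffs f"]) auto
  qed
  show "finite (Poly ` {xs :: 'a list. set xs \<subseteq> UNIV \<and> length xs \<le> Suc n})"
    by (intro finite_imageI finite_lists_length_le) simp
qed

definition moebius_mu :: "nat \<Rightarrow> int" where
  "moebius_mu n = (if squarefree n then (- 1) ^ card (prime_factors n) else 0)"

end

theory Submission
  imports "HOL-Algebra.Algebraic_Closure_Type" Defs
begin

text \<open>
  Let \<open>\<phi> x = x ^ q\<close> be the Frobenius map on the algebraic closure. The roots of a monic irreducible
  polynomial of degree \<open>n\<close> form a \<open>\<phi>\<close>-orbit of length \<open>n\<close>. If such a polynomial is invariant under
  translation by \<open>t \<noteq> 0\<close> and \<open>x\<close> is a root, then \<open>\<phi>\<^sup>j x = x + t\<close> for some \<open>j\<close>. Hence \<open>\<phi>\<^sup>p\<^sup>j x = x\<close>, which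
  forces \<open>n = p e\<close>, and \<open>\<phi>\<^sup>e x - x\<close> is a nonzero \<open>F\<^sub>p\<close>-multiple of \<open>t\<close>. As \<open>\<phi>\<^sup>e x - x\<close> does not depend
  on \<open>t\<close>, the invariance space \<open>S\<close> is at most a line.

  If \<open>S\<close> is a line, the separable equations \<open>\<phi>\<^sup>m x - x = t\<close> with \<open>t \<in> S - {0}\<close> have \<open>(p - 1) q\<^sup>m\<close> solutions
  altogether. These are the roots of the invariant irreducible polynomials of degree \<open>p m / d\<close>, where \<open>d\<close>
  runs over the divisors of \<open>m\<close> prime to \<open>p\<close>, and Moebius inversion gives the count.
\<close>

section \<open>Moebius inversion over divisors prime to p\<close>

text \<open>With \<open>squarefree_eq_prod_prime_factors\<close> this gives the bijection between
  squarefree numbers and finite sets of primes that is used to sum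
  \<open>moebius_mu\<close>.\<close>

lemma prime_factors_prod_primes:
  fixes A :: "nat set"
  assumes "finite A" "\<And>x. x \<in> A \<Longrightarrow> prime x"
  shows "prime_factors (\<Prod>A) = A" "squarefree (\<Prod>A)"
proof -
  have "prime_factorization (\<Prod>A) = mset_set A"
    using assms prime_factorization_prod_mset_primes[of "mset_set A"]
    by (simp add: prod_unfold_prod_mset)
  thus "prime_factors (\<Prod>A) = A"
    using assms by simp
  show "squarefree (\<Prod>A)"
    using assms by (intro squarefree_prod_coprime) (auto intro: squarefree_prime primes_coprime)
qed

lemma squarefree_eq_prod_prime_factors:
  fixes n :: nat
  assumes "squarefree n"
  shows "\<Prod>(prime_factors n) = n"
proof -
  have "n \<noteq> 0" using assms by (auto intro: ccontr)
  have "n = (\<Prod>p\<in>prime_factors n. p ^ multiplicity p n)"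
    using \<open>n \<noteq> 0\<close> by (simp add: prod_prime_factors)
  also have "\<dots> = \<Prod>(prime_factors n)"
  proof (rule prod.cong[OF refl])
    fix p assume "p \<in> prime_factors n"
    then have "multiplicity p n > 0" "multiplicity p n \<le> 1"
      using assms \<open>n \<noteq> 0\<close>
      by (auto simp: prime_factors_multiplicity squarefree_factorial_semiring'')
    then show "p ^ multiplicity p n = p" by (simp add: le_Suc_eq)
  qed
  finally show ?thesis by simp
qed

text \<open>Only squarefree divisors contribute, and they correspond to the subsets of
  \<open>prime_factors n\<close>. The alternating sum over these subsets is the expansion of a
  product of factors 1 - 1, which is empty exactly for n = 1.\<close>

lemma sum_moebius_mu_divisors:
  assumes "n > 0"
  shows "(\<Sum>d | d dvd n. moebius_mu d) = (if n = 1 then 1 else 0)"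
proof -
  have "(\<Sum>d | d dvd n. moebius_mu d) = (\<Sum>d | d dvd n \<and> squarefree d. moebius_mu d)"
    using assms by (intro sum.mono_neutral_right) (auto simp: moebius_mu_def)
  also have "\<dots> = (\<Sum>A\<in>Pow (prime_factors n). (-1) ^ card A)"
  proof (rule sum.reindex_bij_witness[of _ "\<lambda>A. \<Prod>A" prime_factors])
    fix A assume A: "A \<in> Pow (prime_factors n)"
    then have fin: "finite A" and pr: "\<And>x. x \<in> A \<Longrightarrow> prime x"
      by (auto intro: finite_subset)
    have "\<Prod>A dvd \<Prod>(prime_factors n)"
      using A by (intro prod_dvd_prod_subset) auto
    also have "\<dots> dvd (\<Prod>p\<in>prime_factors n. p ^ multiplicity p n)"
      by (intro prod_dvd_prod dvd_power) (auto simp: prime_factors_multiplicity)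
    also have "\<dots> = n"
      using assms by (simp add: prod_prime_factors)
    finally show "\<Prod>A \<in> {d. d dvd n \<and> squarefree d}"
      using prime_factors_prod_primes(2)[OF fin pr] by auto
    show "prime_factors (\<Prod>A) = A"
      using prime_factors_prod_primes(1)[OF fin pr] by auto
  next
    fix d assume d: "d \<in> {d. d dvd n \<and> squarefree d}"
    show "\<Prod>(prime_factors d) = d"
      using d by (simp add: squarefree_eq_prod_prime_factors)
    show "prime_factors d \<in> Pow (prime_factors n)"
      using d assms by (auto intro: dvd_prime_factors[THEN subsetD, rotated])
    show "(-1) ^ card (prime_factors d) = moebius_mu d"
      using d by (simp add: moebius_mu_def)
  qed
  also have "\<dots> = (\<Prod>x\<in>prime_factors n. 1 - 1)"
    by (subst prod_diff_conv_sum) auto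
  also have "\<dots> = (if n = 1 then 1 else 0)"
    using assms by (auto simp: prime_factorization_empty_iff card_gt_0_iff)
  finally show ?thesis .
qed

text \<open>The numbers prime to p are closed under products and divisors. After inserting
  \<open>F\<close>, the pairs (d, b) can therefore be regrouped by c = d b, where d runs over all
  divisors of c. The inner sum of \<open>moebius_mu\<close> leaves only c = 1.\<close>

lemma moebius_inversion_coprime_divisors:
  fixes F G :: "nat \<Rightarrow> real"
  assumes p: "prime p" and "m > 0"
    and F: "\<And>n. n > 0 \<Longrightarrow> F n = (\<Sum>d | d dvd n \<and> \<not> p dvd d. G (n div d))"
  shows "G m = (\<Sum>d | d dvd m \<and> \<not> p dvd d. of_int (moebius_mu d) * F (m div d))"
proof -
  have fin: "finite {d. d dvd n \<and> Q d}" if "n > 0" for n :: nat and Q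
    using that by (auto intro: finite_subset[OF _ finite_divisors_nat[OF that]])
  have "(\<Sum>d | d dvd m \<and> \<not> p dvd d. of_int (moebius_mu d) * F (m div d)) =
      (\<Sum>d | d dvd m \<and> \<not> p dvd d. \<Sum>b | b dvd m div d \<and> \<not> p dvd b.
         of_int (moebius_mu d) * G (m div d div b))"
    using \<open>m > 0\<close> by (intro sum.cong refl) (auto simp: F sum_distrib_left)
  also have "\<dots> = (\<Sum>(d, b) \<in> (SIGMA d:{d. d dvd m \<and> \<not> p dvd d}. {b. b dvd m div d \<and> \<not> p dvd b}).
      of_int (moebius_mu d) * G (m div d div b))"
    using \<open>m > 0\<close> by (intro sum.Sigma ballI fin) auto
  also have "\<dots> = (\<Sum>(c, d) \<in> (SIGMA c:{c. c dvd m \<and> \<not> p dvd c}. {d. d dvd c}).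
      of_int (moebius_mu d) * G (m div c))"
  proof (rule sum.reindex_bij_witness[of _ "\<lambda>(c, d). (d, c div d)" "\<lambda>(d, b). (d * b, d)"], goal_cases)
    case (2 x)
    then obtain d b where x: "x = (d, b)" "d dvd m" "\<not> p dvd d" "b dvd m div d" "\<not> p dvd b"
      by auto
    then have "d * b dvd m"
      by (metis dvd_mult_div_cancel mult_dvd_mono dvd_refl)
    with x p show ?case by (auto simp: prime_dvd_mult_iff)
  next
    case (4 y)
    then obtain c d where y: "y = (c, d)" "c dvd m" "\<not> p dvd c" "d dvd c"
      by auto
    moreover from y have "c div d dvd m div d"
      by (simp add: div_dvd_div dvd_trans)
    moreover from y have "\<not> p dvd c div d"
      by (metis dvd_div_mult_self dvd_mult2)
    ultimately show ?case by (auto dest: dvd_trans)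
  qed (use \<open>m > 0\<close> in \<open>auto simp: div_mult2_eq\<close>)
  also have "\<dots> = (\<Sum>c | c dvd m \<and> \<not> p dvd c. \<Sum>d | d dvd c. of_int (moebius_mu d) * G (m div c))"
    using \<open>m > 0\<close> by (intro sum.Sigma[symmetric] ballI fin finite_divisors_nat) (auto intro: Nat.gr0I)
  also have "\<dots> = (\<Sum>c | c dvd m \<and> \<not> p dvd c. if c = 1 then G m else 0)"
  proof (rule sum.cong[OF refl])
    fix c assume "c \<in> {c. c dvd m \<and> \<not> p dvd c}"
    then have "c > 0" using \<open>m > 0\<close> by (auto intro: Nat.gr0I)
    have "(\<Sum>d | d dvd c. of_int (moebius_mu d) * G (m div c)) =
        of_int (\<Sum>d | d dvd c. moebius_mu d) * G (m div c)"
      by (simp add: sum_distrib_right)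
    then show "(\<Sum>d | d dvd c. of_int (moebius_mu d) * G (m div c)) = (if c = 1 then G m else 0)"
      unfolding sum_moebius_mu_divisors[OF \<open>c > 0\<close>] by simp
  qed
  also have "\<dots> = G m"
    using p \<open>m > 0\<close> by (subst sum.delta) (auto simp: fin)
  finally show ?thesis by simp
qed

section \<open>Roots in the algebraic closure\<close>

text \<open>P splits into linear factors, and a repeated factor would make its root a root of the
  derivative. Hence the multiset of roots is a set.\<close>

lemma card_roots_separable:
  fixes P :: "'a :: alg_closed_field poly"
  assumes "P \<noteq> 0" and sep: "\<And>a. poly P a = 0 \<Longrightarrow> poly (pderiv P) a \<noteq> 0"
  shows "card {x. poly P x = 0} = degree P"
proof -
  obtain A where A: "size A = degree P" "P = smult (lead_coeff P) (\<Prod>x\<in>#A. [:-x, 1:])"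
    using alg_closed_imp_factorization[OF \<open>P \<noteq> 0\<close>] by blast
  have lc: "lead_coeff P \<noteq> 0" using \<open>P \<noteq> 0\<close> by simp
  have roots: "{x. poly P x = 0} = set_mset A"
    by (subst A(2)) (use lc in \<open>auto simp: poly_prod_mset image_iff\<close>)
  have "count A a = 1" if "a \<in># A" for a
  proof (rule ccontr)
    assume "count A a \<noteq> 1"
    with that obtain B where B: "A = add_mset a (add_mset a B)"
      by (metis One_nat_def count_add_mset count_eq_zero_iff multi_member_split)
    define R where "R = smult (lead_coeff P) (\<Prod>x\<in>#B. [:-x, 1:])"
    have "P = smult (lead_coeff P) ([:-a, 1:] * ([:-a, 1:] * (\<Prod>x\<in>#B. [:-x, 1:])))"
      using A(2) unfolding B image_mset_add_mset prod_mset.add_mset .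
    then have R: "P = [:-a, 1:] * ([:-a, 1:] * R)"
      unfolding R_def mult_smult_right .
    have "poly P a = 0"
      by (subst R) simp
    moreover have "poly (pderiv P) a = 0"
      by (subst R, subst pderiv_mult) simp
    ultimately show False using sep by blast
  qed
  then have "A = mset_set (set_mset A)"
    by (intro multiset_eqI) (auto simp: count_mset_set' not_in_iff)
  then have "card (set_mset A) = size A"
    by (metis size_mset_set)
  with roots A(1) show ?thesis by simp
qed

interpretation to_ac: inj_idom_hom "to_ac :: 'a :: field \<Rightarrow> 'a alg_closure"
  by unfold_locales auto

interpretation map_poly_to_ac: map_poly_inj_idom_hom "to_ac :: 'a :: field \<Rightarrow> 'a alg_closure"
  by unfold_locales

definition ac_roots :: "'a :: field poly \<Rightarrow> 'a alg_closure set" where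
  "ac_roots f = {x. poly (map_poly to_ac f) x = 0}"

lemma finite_ac_roots: "f \<noteq> 0 \<Longrightarrow> finite (ac_roots f)"
  unfolding ac_roots_def by (rule poly_roots_finite) simp

lemma card_ac_roots_le: "f \<noteq> 0 \<Longrightarrow> card (ac_roots f) \<le> degree f"
  unfolding ac_roots_def using card_poly_roots_bound[of "map_poly to_ac f"] by simp

lemma ac_roots_mult: "ac_roots (f * g) = ac_roots f \<union> ac_roots g"
  by (auto simp: ac_roots_def map_poly_to_ac.hom_mult)

lemma mem_ac_roots_pcompose_translation:
  "x \<in> ac_roots (pcompose f [:s, 1:]) \<longleftrightarrow> x + to_ac s \<in> ac_roots f"
  by (simp add: ac_roots_def to_ac.map_poly_pcompose poly_pcompose map_poly_to_ac.hom_add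
      map_poly_pCons add.commute)

lemma ac_roots_nonempty:
  fixes f :: "'a :: field poly"
  assumes "irreducible f"
  shows "ac_roots f \<noteq> {}"
proof -
  have "degree f > 0"
    using assms by (metis gr0I irreducible_def is_unit_iff_degree)
  then show ?thesis
    using alg_closed_imp_poly_has_root[of "map_poly to_ac f"] by (auto simp: ac_roots_def)
qed

text \<open>Division with remainder shows that a nonzero polynomial of least degree vanishing at x
  divides every polynomial vanishing at x. Both irreducibles are thus scalar multiples of it, and
  being monic fixes the scalar.\<close>

lemma irreducible_monic_common_root_eq:
  fixes f g :: "'a :: field poly"
  assumes "irreducible f" "irreducible g" "lead_coeff f = 1" "lead_coeff g = 1"
    and "x \<in> ac_roots f" "x \<in> ac_roots g"
  shows "f = g"
proof -
  \<comment> \<open>\<open>d\<close> plays the role of a gcd, which polynomials over an arbitrary \<open>field\<close> type lack.\<close>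
  define d where "d = (ARG_MIN degree d. d \<noteq> 0 \<and> x \<in> ac_roots d)"
  have "f \<noteq> 0" using assms(1) by auto
  then have d: "d \<noteq> 0" "x \<in> ac_roots d"
    and min: "\<And>h. h \<noteq> 0 \<Longrightarrow> x \<in> ac_roots h \<Longrightarrow> degree d \<le> degree h"
    using arg_min_nat_lemma[of "\<lambda>d. d \<noteq> 0 \<and> x \<in> ac_roots d" f degree] assms(5)
    by (auto simp: d_def)
  have dvd: "d dvd h" if "x \<in> ac_roots h" for h
  proof (rule ccontr)
    assume "\<not> d dvd h"
    then have nz: "h mod d \<noteq> 0" by (simp add: dvd_eq_mod_eq_0)
    have "h mod d = h - h div d * d"
      by (simp add: minus_div_mult_eq_mod)
    then have "x \<in> ac_roots (h mod d)"
      using that d by (simp add: ac_roots_def map_poly_to_ac.hom_minus map_poly_to_ac.hom_mult)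
    with min nz have "degree d \<le> degree (h mod d)" by blast
    moreover have "degree (h mod d) < degree d"
      using degree_mod_less[OF d(1), of h] nz by blast
    ultimately show False by simp
  qed
  have nonunit: "\<not> is_unit d"
  proof
    assume "is_unit d"
    then obtain c where "d = [:c:]" by (metis is_unit_poly_iff)
    with d show False by (auto simp: ac_roots_def map_poly_pCons)
  qed
  have smult: "\<exists>c. h = smult c d" if h: "irreducible h" "x \<in> ac_roots h" for h
  proof -
    obtain u where u: "h = d * u" using dvd[OF h(2)] by (elim dvdE)
    with h(1) nonunit have "is_unit u"
      using irreducibleD by blast
    then obtain c where "u = [:c:]" by (metis is_unit_poly_iff)
    with u show ?thesis by auto
  qed
  obtain a b where ab: "f = smult a d" "g = smult b d"
    using smult assms by metis
  with assms(3,4) have "a * lead_coeff d = 1" "b * lead_coeff d = 1"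
    by (metis lead_coeff_smult)+
  then have "a = b"
    by (metis mult.assoc mult.commute mult_1)
  with ab show ?thesis by simp
qed

text \<open>This carries invariance under one nonzero element over to the line it generates.\<close>

lemma translation_invariant_multiple:
  fixes f :: "'a :: comm_ring_1 poly"
  assumes "pcompose f [:t, 1:] = f"
  shows "pcompose f [:of_nat i * t, 1:] = f"
proof (induction i)
  case 0
  then show ?case by (simp add: pcompose_idR)
next
  case (Suc i)
  have "[:of_nat (Suc i) * t, 1:] = pcompose [:of_nat i * t, 1:] [:t, 1:]"
    by (simp add: pcompose_pCons algebra_simps)
  then show ?case
    by (metis Suc assms pcompose_assoc)
qed

lemma irreducible_pcompose_translation:
  assumes "irreducible (f :: 'a :: field poly)"
  shows "irreducible (pcompose f [:t, 1:])"
proof -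
  have inv: "pcompose (pcompose h [:s, 1:]) [:- s, 1:] = h" for h :: "'a poly" and s
    by (simp add: pcompose_pCons flip: pcompose_assoc)
  have unit: "is_unit (pcompose h [:s, 1:]) \<longleftrightarrow> is_unit h" for h :: "'a poly" and s
    by (auto simp: is_unit_iff_degree pcompose_eq_0)
  show ?thesis
  proof (rule irreducibleI)
    show "pcompose f [:t, 1:] \<noteq> 0"
      using assms inv[of f t] by auto
    show "\<not> is_unit (pcompose f [:t, 1:])"
      using assms unit irreducible_not_unit by blast
    fix a b assume "pcompose f [:t, 1:] = a * b"
    then have "f = pcompose a [:- t, 1:] * pcompose b [:- t, 1:]"
      using inv[of f t] by (simp add: pcompose_mult)
    then show "is_unit a \<or> is_unit b"
      using assms irreducibleD unit by blast
  qed
qed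

section \<open>Frobenius orbits\<close>

text \<open>This is the degree of x over the base field, as \<open>ex_minimal_polynomial\<close>
  shows. The set under \<open>LEAST\<close> is nonempty by \<open>ex_frob_period\<close>.\<close>

definition frob_order :: "'a :: finite_field alg_closure \<Rightarrow> nat" where
  "frob_order x = (LEAST n. n > 0 \<and> x ^ (CARD('a) ^ n) = x)"

definition frob_orbit :: "'a :: finite_field alg_closure \<Rightarrow> 'a alg_closure set" where
  "frob_orbit x = range (\<lambda>j. x ^ (CARD('a) ^ j))"

text \<open>For a line S these are the roots of the invariant irreducible polynomials of degree p e
  (\<open>line_roots_eq_UN\<close>), described by Frobenius alone.\<close>

definition line_roots :: "'a :: finite_field set \<Rightarrow> nat \<Rightarrow> 'a alg_closure set" where
  "line_roots S e =
     {x. frob_order x = CHAR('a) * e \<and> x ^ (CARD('a) ^ e) - x \<in> to_ac ` (S - {0})}"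

lemma pow_CARD_pow_CARD:
  "(x ^ (CARD('a :: finite_field) ^ i)) ^ (CARD('a) ^ j) = (x :: 'b :: monoid_mult) ^ (CARD('a) ^ (i + j))"
  by (simp add: power_add flip: power_mult)

lemma to_ac_pow_CARD [simp]:
  "to_ac (a :: 'a :: finite_field) ^ (CARD('a) ^ n) = to_ac a"
  using finite_field_power_card_power_eq_same[OF refl, of a n] by (metis to_ac_power)

text \<open>The polynomial is X^n - X - t. It is used with t = 0 for the fixed field of Frobenius
  and with general t for the translation equations.\<close>

lemma degree_monom_minus_linear:
  assumes "n > 1"
  shows "degree (monom 1 n - [:t, 1:] :: 'a :: comm_ring_1 poly) = n"
proof (rule antisym)
  show "degree (monom 1 n - [:t, 1:] :: 'a poly) \<le> n"
    using assms by (intro degree_diff_le degree_monom_le) auto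
  have "coeff (monom 1 n - [:t, 1:] :: 'a poly) n = 1"
    using assms by (simp add: coeff_pCons split: nat.split)
  then show "n \<le> degree (monom 1 n - [:t, 1:] :: 'a poly)"
    by (intro le_degree) simp
qed

text \<open>X^q - X has at most q roots, and the q elements of the base field already are
  roots.\<close>

lemma pow_CARD_eq_self_imp_range_to_ac:
  fixes x :: "'a :: finite_field alg_closure"
  assumes "x ^ CARD('a) = x"
  shows "x \<in> range to_ac"
proof -
  define P :: "'a alg_closure poly" where "P = monom 1 CARD('a) - [:0, 1:]"
  have "CARD('a) > 1"
    using card_mono[of UNIV "{0, 1 :: 'a}"] by simp
  then have deg: "degree P = CARD('a)"
    unfolding P_def by (rule degree_monom_minus_linear)
  with \<open>CARD('a) > 1\<close> have "P \<noteq> 0" by auto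
  have P: "poly P y = y ^ CARD('a) - y" for y
    by (simp add: P_def poly_monom)
  have fin: "finite {y. poly P y = 0}" by (rule poly_roots_finite) fact
  moreover have sub: "range to_ac \<subseteq> {y. poly P y = 0}"
    using to_ac_pow_CARD[of _ 1] by (auto simp: P)
  moreover have "card {y. poly P y = 0} \<le> card (range (to_ac :: 'a \<Rightarrow> _))"
    using card_poly_roots_bound[OF \<open>P \<noteq> 0\<close>] deg by (simp add: card_image inj_to_ac)
  ultimately have "range to_ac = {y. poly P y = 0}"
    by (intro card_subset_eq) (auto intro!: antisym card_mono)
  with assms show ?thesis by (simp add: P)
qed

context
  fixes k :: nat
  assumes CARD_eq: "CARD('a :: finite_field) = CHAR('a) ^ k"
begin

lemma frob_add:
  "(x + y :: 'a alg_closure) ^ (CARD('a) ^ n) = x ^ (CARD('a) ^ n) + y ^ (CARD('a) ^ n)"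
  by (rule freshmans_dream'[where n = "k * n"]) (simp_all add: CARD_eq power_mult)

lemma frob_diff:
  "(x - y :: 'a alg_closure) ^ (CARD('a) ^ n) = x ^ (CARD('a) ^ n) - y ^ (CARD('a) ^ n)"
  using frob_add[of "x - y" y n] by (simp add: algebra_simps)

lemma frob_eq_iff:
  "(x :: 'a alg_closure) ^ (CARD('a) ^ n) = y ^ (CARD('a) ^ n) \<longleftrightarrow> x = y"
  using frob_diff[of x y n] by auto

text \<open>Frobenius is a ring homomorphism fixing the coefficients, which lie in the base field,
  so it commutes with evaluation.\<close>

lemma poly_map_poly_to_ac_frob:
  "poly (map_poly to_ac f) (x ^ (CARD('a) ^ n)) = poly (map_poly to_ac (f :: 'a poly)) x ^ (CARD('a) ^ n)"
  by (induction f) (simp_all add: map_poly_pCons frob_add power_mult_distrib power_0_left)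

lemma frob_mem_ac_roots_iff:
  "x ^ (CARD('a) ^ n) \<in> ac_roots (f :: 'a poly) \<longleftrightarrow> x \<in> ac_roots f"
  by (simp add: ac_roots_def poly_map_poly_to_ac_frob)

text \<open>All Frobenius iterates of x are roots of one nonzero polynomial, so two of them
  coincide. Injectivity of Frobenius cancels the smaller exponent.\<close>

lemma ex_frob_period: "\<exists>n>0. (x :: 'a alg_closure) ^ (CARD('a) ^ n) = x"
proof -
  obtain f :: "'a poly" where f: "f \<noteq> 0" "x \<in> ac_roots f"
    using alg_closure_algebraic[of x] unfolding ac_roots_def by auto
  have "range (\<lambda>n. x ^ (CARD('a) ^ n)) \<subseteq> ac_roots f"
    using f frob_mem_ac_roots_iff by auto
  then have "finite (range (\<lambda>n. x ^ (CARD('a) ^ n)))"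
    using finite_ac_roots[OF f(1)] finite_subset by blast
  then have "\<not> inj (\<lambda>n :: nat. x ^ (CARD('a) ^ n))"
    using finite_imageD infinite_UNIV_nat by blast
  then obtain i j where ij: "i < j" "x ^ (CARD('a) ^ i) = x ^ (CARD('a) ^ j)"
    unfolding inj_def by (metis linorder_neqE_nat)
  then have "x ^ (CARD('a) ^ i) = (x ^ (CARD('a) ^ (j - i))) ^ (CARD('a) ^ i)"
    by (simp add: pow_CARD_pow_CARD)
  then have "x = x ^ (CARD('a) ^ (j - i))"
    unfolding frob_eq_iff .
  with ij(1) show ?thesis by (intro exI[of _ "j - i"]) auto
qed

lemma frob_order_pos: "frob_order (x :: 'a alg_closure) > 0"
  and frob_order_fixes: "(x :: 'a alg_closure) ^ (CARD('a) ^ frob_order x) = x"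
  using LeastI_ex[OF ex_frob_period[of x]] unfolding frob_order_def by blast+

lemma frob_mult_period:
  assumes "(x :: 'a alg_closure) ^ (CARD('a) ^ n) = x"
  shows "x ^ (CARD('a) ^ (n * l)) = x"
proof (induction l)
  case (Suc l)
  have "x ^ (CARD('a) ^ (n * Suc l)) = (x ^ (CARD('a) ^ n)) ^ (CARD('a) ^ (n * l))"
    by (simp add: pow_CARD_pow_CARD)
  with assms Suc show ?case by simp
qed simp

lemma frob_mod_order:
  "(x :: 'a alg_closure) ^ (CARD('a) ^ n) = x ^ (CARD('a) ^ (n mod frob_order x))"
proof -
  have "x ^ (CARD('a) ^ n) = (x ^ (CARD('a) ^ (frob_order x * (n div frob_order x)))) ^ (CARD('a) ^ (n mod frob_order x))"
    by (simp add: pow_CARD_pow_CARD)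
  then show ?thesis
    by (simp add: frob_mult_period[OF frob_order_fixes])
qed

lemma frob_fixes_iff: "(x :: 'a alg_closure) ^ (CARD('a) ^ n) = x \<longleftrightarrow> frob_order x dvd n"
proof
  assume "x ^ (CARD('a) ^ n) = x"
  then have "x ^ (CARD('a) ^ (n mod frob_order x)) = x"
    using frob_mod_order[of x n] by simp
  moreover have "n mod frob_order x < frob_order x"
    using frob_order_pos by simp
  ultimately have "n mod frob_order x = 0"
    using not_less_Least[of "n mod frob_order x" "\<lambda>n. n > 0 \<and> x ^ (CARD('a) ^ n) = x"]
    unfolding frob_order_def by auto
  then show "frob_order x dvd n" by (simp add: dvd_eq_mod_eq_0)
next
  assume "frob_order x dvd n"
  then show "x ^ (CARD('a) ^ n) = x"
    by (auto simp: frob_mult_period[OF frob_order_fixes] elim!: dvdE)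
qed

lemma frob_orbit_eq: "frob_orbit (x :: 'a alg_closure) = (\<lambda>j. x ^ (CARD('a) ^ j)) ` {..<frob_order x}"
proof
  show "frob_orbit x \<subseteq> (\<lambda>j. x ^ (CARD('a) ^ j)) ` {..<frob_order x}"
  proof
    fix y assume "y \<in> frob_orbit x"
    then obtain j where "y = x ^ (CARD('a) ^ (j mod frob_order x))"
      unfolding frob_orbit_def using frob_mod_order by blast
    then show "y \<in> (\<lambda>j. x ^ (CARD('a) ^ j)) ` {..<frob_order x}"
      using frob_order_pos by (auto intro!: imageI)
  qed
qed (auto simp: frob_orbit_def)

lemma card_frob_orbit: "card (frob_orbit (x :: 'a alg_closure)) = frob_order x"
proof -
  have "inj_on (\<lambda>j. x ^ (CARD('a) ^ j)) {..<frob_order x}"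
  proof (rule linorder_inj_onI)
    fix i j assume ij: "i < j" "i \<in> {..<frob_order x}" "j \<in> {..<frob_order x}"
    show "x ^ (CARD('a) ^ i) \<noteq> x ^ (CARD('a) ^ j)"
    proof
      assume "x ^ (CARD('a) ^ i) = x ^ (CARD('a) ^ j)"
      with ij have "x ^ (CARD('a) ^ i) = (x ^ (CARD('a) ^ (j - i))) ^ (CARD('a) ^ i)"
        by (simp add: pow_CARD_pow_CARD)
      then have "frob_order x dvd j - i"
        using frob_eq_iff frob_fixes_iff by metis
      with ij show False by (auto dest: dvd_imp_le)
    qed
  qed auto
  then show ?thesis by (simp add: frob_orbit_eq card_image)
qed

lemma frob_orbit_self: "x \<in> frob_orbit (x :: 'a alg_closure)"
  unfolding frob_orbit_def by (auto intro: image_eqI[of _ _ 0])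

lemma finite_frob_orbit: "finite (frob_orbit (x :: 'a alg_closure))"
  by (simp add: frob_orbit_eq)

lemma frob_image_frob_orbit: "(\<lambda>y. y ^ CARD('a)) ` frob_orbit (x :: 'a alg_closure) = frob_orbit x"
proof (rule endo_inj_surj)
  show "(\<lambda>y. y ^ CARD('a)) ` frob_orbit x \<subseteq> frob_orbit x"
    using pow_CARD_pow_CARD[of x _ 1, where 'a = 'a]
    by (auto simp: frob_orbit_def simp flip: power_Suc)
  show "inj_on (\<lambda>y. y ^ CARD('a)) (frob_orbit x)"
    using frob_eq_iff[of _ 1] by (auto intro!: inj_onI)
qed (rule finite_frob_orbit)

lemma frob_orbit_subset_ac_roots: "x \<in> ac_roots (f :: 'a poly) \<Longrightarrow> frob_orbit x \<subseteq> ac_roots f"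
  by (auto simp: frob_orbit_def frob_mem_ac_roots_iff)

lemma ex_minimal_polynomial:
  fixes x :: "'a alg_closure"
  obtains g :: "'a poly" where "lead_coeff g = 1" "irreducible g" "degree g = frob_order x"
    "ac_roots g = frob_orbit x"
proof -
  \<comment> \<open>\<open>h\<close> is stable under Frobenius, so its coefficients descend to the base field.\<close>
  define h where "h = (\<Prod>y\<in>frob_orbit x. [:-y, 1:])"
  interpret frob: comm_ring_hom "\<lambda>y :: 'a alg_closure. y ^ CARD('a)"
    using frob_add[of _ _ 1] by unfold_locales (auto simp: power_mult_distrib)
  interpret map_frob: map_poly_comm_ring_hom "\<lambda>y :: 'a alg_closure. y ^ CARD('a)" ..
  have uminus: "(- y) ^ CARD('a) = - (y ^ CARD('a))" for y :: "'a alg_closure"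
    using frob.hom_uminus .
  have "map_poly (\<lambda>y. y ^ CARD('a)) h = (\<Prod>y\<in>frob_orbit x. [:- (y ^ CARD('a)), 1:])"
    by (simp add: h_def map_frob.hom_prod map_poly_pCons uminus)
  also have "\<dots> = (\<Prod>y\<in>(\<lambda>y. y ^ CARD('a)) ` frob_orbit x. [:-y, 1:])"
    by (subst prod.reindex) (use frob_eq_iff[of _ 1] in \<open>auto intro!: inj_onI\<close>)
  also have "\<dots> = h"
    by (simp add: h_def frob_image_frob_orbit)
  finally have "coeff h i ^ CARD('a) = coeff h i" for i
    by (metis frob.coeff_map_poly_hom)
  then have "coeff h i \<in> range to_ac" for i
    using pow_CARD_eq_self_imp_range_to_ac by blast
  then have coeff: "to_ac (of_ac (coeff h i)) = coeff h i" for i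
    using to_ac_of_ac by blast
  define g where "g = map_poly of_ac h"
  have g: "map_poly to_ac g = h"
    by (intro poly_eqI) (simp add: g_def coeff_map_poly coeff)
  have roots: "ac_roots g = frob_orbit x"
    unfolding ac_roots_def g h_def by (auto simp: poly_prod finite_frob_orbit)
  have lc: "lead_coeff h = 1"
    unfolding h_def by (simp add: lead_coeff_prod)
  have deg: "degree g = frob_order x"
  proof -
    have "degree g = degree h" by (metis g to_ac.degree_map_poly_hom)
    also have "\<dots> = card (frob_orbit x)"
      unfolding h_def by (subst degree_prod_eq_sum_degree) auto
    finally show ?thesis by (simp add: card_frob_orbit)
  qed
  have monic: "lead_coeff g = 1"
    using lc g by (metis to_ac.hom_lead_coeff to_ac_1 to_ac_eq_iff)
  have "irreducible g"
  proof (rule irreducibleI)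
    show "g \<noteq> 0" using monic by auto
    show "\<not> is_unit g"
      using deg frob_order_pos[of x] by (auto simp: is_unit_iff_degree \<open>g \<noteq> 0\<close>)
    \<comment> \<open>A factor vanishing at x vanishes on the whole orbit, so it already has the
      full degree of \<open>g\<close> and its cofactor is constant.\<close>
    have unit: "is_unit b" if "g = a * b" "x \<in> ac_roots a" for a b
    proof -
      have nz: "a \<noteq> 0" "b \<noteq> 0" using that \<open>g \<noteq> 0\<close> by auto
      have "frob_order x \<le> card (ac_roots a)"
        using card_mono[OF finite_ac_roots frob_orbit_subset_ac_roots] nz that
        by (simp add: card_frob_orbit)
      also have "\<dots> \<le> degree a"
        using nz by (intro card_ac_roots_le)
      finally have "degree b = 0"
        using deg that(1) degree_mult_eq[OF nz] by simp
      then show ?thesis using nz by (simp add: is_unit_iff_degree)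
    qed
    fix a b assume ab: "g = a * b"
    moreover have "x \<in> ac_roots a \<union> ac_roots b"
      using roots frob_orbit_self unfolding ab ac_roots_mult by blast
    ultimately show "is_unit a \<or> is_unit b"
      using unit[of a b] unit[of b a] by (auto simp: mult.commute)
  qed
  with monic deg roots that show thesis by blast
qed

lemma irreducible_degree_and_ac_roots:
  assumes "irreducible (f :: 'a poly)" "lead_coeff f = 1" "x \<in> ac_roots f"
  shows "degree f = frob_order x" "ac_roots f = frob_orbit x"
proof -
  obtain g :: "'a poly" where g: "lead_coeff g = 1" "irreducible g" "degree g = frob_order x"
    "ac_roots g = frob_orbit x"
    by (rule ex_minimal_polynomial)
  then have "f = g"
    using assms frob_orbit_self by (intro irreducible_monic_common_root_eq) auto
  with g show "degree f = frob_order x" "ac_roots f = frob_orbit x" by auto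
qed

section \<open>Elements translated by a power of Frobenius\<close>

text \<open>The solutions are the roots of X^(q^m) - X - t. Its derivative is -1 because p divides
  q^m, so all roots are simple.\<close>

lemma card_pow_CARD_eq_translate:
  assumes "m > 0"
  shows "card {x :: 'a alg_closure. x ^ (CARD('a) ^ m) = x + to_ac t} = CARD('a) ^ m"
proof -
  define P :: "'a alg_closure poly" where "P = monom 1 (CARD('a) ^ m) - [:to_ac t, 1:]"
  have "CARD('a) > 1"
    using card_mono[of UNIV "{0, 1 :: 'a}"] by simp
  then have "CARD('a) ^ m > 1"
    using assms by (rule one_less_power)
  then have deg: "degree P = CARD('a) ^ m"
    unfolding P_def by (rule degree_monom_minus_linear)
  with \<open>CARD('a) ^ m > 1\<close> have "P \<noteq> 0" by auto
  have "CHAR('a) dvd CARD('a) ^ m"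
    using CHAR_dvd_CARD assms by (metis dvd_power dvd_trans)
  then have "of_nat (CARD('a) ^ m) = (0 :: 'a alg_closure)"
    by (subst of_nat_eq_0_iff_char_dvd) simp
  then have "pderiv P = - 1"
    unfolding P_def pderiv_diff pderiv_monom mult_1_right
    by (simp add: pderiv_pCons one_pCons del: of_nat_power)
  with \<open>P \<noteq> 0\<close> have "card {x. poly P x = 0} = degree P"
    by (intro card_roots_separable) auto
  moreover have "{x. poly P x = 0} = {x. x ^ (CARD('a) ^ m) = x + to_ac t}"
    by (auto simp: P_def poly_monom algebra_simps)
  ultimately show ?thesis using deg by simp
qed

text \<open>Frobenius fixes t, so each further application of \<phi>^e adds t once more.\<close>

lemma frob_translate_iterate:
  assumes "(x :: 'a alg_closure) ^ (CARD('a) ^ e) = x + to_ac t"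
  shows "x ^ (CARD('a) ^ (e * d)) = x + to_ac (of_nat d * t)"
proof (induction d)
  case (Suc d)
  have "x ^ (CARD('a) ^ (e * Suc d)) = (x ^ (CARD('a) ^ (e * d))) ^ (CARD('a) ^ e)"
    by (simp add: pow_CARD_pow_CARD add.commute)
  also have "\<dots> = x + to_ac t + to_ac (of_nat d * t)"
    unfolding Suc frob_add to_ac_pow_CARD assms ..
  finally show ?case by (simp add: algebra_simps)
qed simp

text \<open>Iterating p times adds p t = 0, so the order N of x divides j p, while N does not divide
  j since t is nonzero. As p is prime, this forces N = p e with e dividing j and j / e prime to p. A
  suitable power of \<phi>^j then acts on x as \<phi>^e.\<close>

lemma frob_order_if_frob_translate:
  assumes j: "(x :: 'a alg_closure) ^ (CARD('a) ^ j) = x + to_ac t" and "t \<noteq> 0"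
  obtains e i where "frob_order x = CHAR('a) * e" "e dvd j" "\<not> CHAR('a) dvd j div e"
    "\<not> CHAR('a) dvd i" "x ^ (CARD('a) ^ e) = x + to_ac (of_nat i * t)"
proof -
  let ?p = "CHAR('a)" and ?N = "frob_order x"
  have p: "prime ?p" by simp
  have "x ^ (CARD('a) ^ (j * ?p)) = x"
    using frob_translate_iterate[OF j, of ?p] by simp
  then have N1: "?N dvd j * ?p" by (simp add: frob_fixes_iff)
  have N2: "\<not> ?N dvd j"
    using assms by (simp flip: frob_fixes_iff)
  have "?p dvd ?N"
  proof (rule ccontr)
    assume "\<not> ?p dvd ?N"
    then have "coprime ?N ?p"
      using p by (metis coprime_commute prime_imp_coprime)
    with N1 N2 show False by (simp add: coprime_dvd_mult_left_iff)
  qed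
  then obtain e where e: "?N = ?p * e" by (elim dvdE)
  have "e dvd j"
    using N1 e p by (simp add: mult.commute)
  then obtain d where d: "j = e * d" by (elim dvdE)
  have "e > 0" using e frob_order_pos[of x] by (auto intro: gr0I)
  have "\<not> ?p dvd d"
    using N2 e d by auto
  then have "coprime d ?p"
    using p by (metis coprime_commute prime_imp_coprime)
  \<comment> \<open>Choosing i inverse to d = j / e modulo p makes j i congruent to e modulo N = p
    e.\<close>
  then obtain i where "[d * i = 1] (mod ?p)"
    using cong_solve_coprime_nat[of d ?p] by auto
  then have "d * i mod ?p = 1"
    using prime_gt_1_nat[OF p] by (simp add: cong_def)
  then obtain l where l: "d * i = 1 + ?p * l"
    by (metis add.commute mult_div_mod_eq)
  have "\<not> ?p dvd i"
    using \<open>d * i mod ?p = 1\<close> by (metis dvd_mult mod_0_imp_dvd dvd_imp_mod_0 zero_neq_one)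
  have "j * i = ?N * l + e"
    unfolding d e mult.assoc l by (simp add: algebra_simps)
  then have "x ^ (CARD('a) ^ (j * i)) = (x ^ (CARD('a) ^ (?N * l))) ^ (CARD('a) ^ e)"
    by (simp add: pow_CARD_pow_CARD)
  also have "\<dots> = x ^ (CARD('a) ^ e)"
    by (simp add: frob_mult_period[OF frob_order_fixes])
  finally have "x ^ (CARD('a) ^ e) = x + to_ac (of_nat i * t)"
    using frob_translate_iterate[OF j, of i] by simp
  with e \<open>e dvd j\<close> \<open>\<not> ?p dvd d\<close> \<open>\<not> ?p dvd i\<close> d \<open>e > 0\<close> that show thesis by simp
qed

text \<open>By invariance x + t is again a root of f, hence some Frobenius iterate of x, so
  \<open>frob_order_if_frob_translate\<close> applies. Note that e = n / p does not depend on
  t.\<close>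

lemma translation_invariant_root:
  assumes f: "f \<in> invariant_irreducibles (S :: 'a set) n" and x: "x \<in> ac_roots f"
    and t: "t \<in> S" "t \<noteq> 0"
  obtains e i where "n = CHAR('a) * e" "frob_order x = n" "\<not> CHAR('a) dvd i"
    "x ^ (CARD('a) ^ e) = x + to_ac (of_nat i * t)"
proof -
  have f': "irreducible f" "lead_coeff f = 1" "degree f = n" "pcompose f [:t, 1:] = f"
    using f t by (auto simp: invariant_irreducibles_def translation_invariant_def)
  have "x + to_ac t \<in> ac_roots f"
    using x f'(4) mem_ac_roots_pcompose_translation by metis
  then obtain j where "x ^ (CARD('a) ^ j) = x + to_ac t"
    using irreducible_degree_and_ac_roots(2)[OF f'(1,2) x] by (auto simp: frob_orbit_def)
  moreover have "frob_order x = n"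
    using irreducible_degree_and_ac_roots(1)[OF f'(1,2) x] f'(3) by simp
  ultimately show thesis
    using frob_order_if_frob_translate[of x j t] t(2) that by metis
qed

section \<open>Counting roots and polynomials for a fixed line S\<close>

context
  fixes S :: "'a set"
  assumes zero_in_S: "0 \<in> S" and card_S: "card S = CHAR('a)"
    and S_line: "\<And>t. t \<in> S \<Longrightarrow> t \<noteq> 0 \<Longrightarrow> S = range (\<lambda>i. of_nat i * t)"
begin

text \<open>If \<phi>^e x = x + t, then x + t is conjugate to x, so the minimal polynomial of x and
  its translate by t share the root x and coincide. Invariance under t spreads to S because t
  generates it. Conversely, \<open>translation_invariant_root\<close> gives \<phi>^e x - x = i t
  with p not dividing i, a nonzero element of S.\<close>

lemma line_roots_eq_UN:
  "line_roots S e = (\<Union>f\<in>invariant_irreducibles S (CHAR('a) * e). ac_roots f)"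
proof (intro equalityI subsetI)
  fix x assume "x \<in> line_roots S e"
  then obtain t where x: "frob_order x = CHAR('a) * e" "t \<in> S" "t \<noteq> 0" "x ^ (CARD('a) ^ e) = x + to_ac t"
    by (fastforce simp: line_roots_def algebra_simps)
  obtain f :: "'a poly" where f: "lead_coeff f = 1" "irreducible f" "degree f = frob_order x"
    "ac_roots f = frob_orbit x"
    by (rule ex_minimal_polynomial)
  have "x + to_ac t \<in> ac_roots f"
    unfolding f frob_orbit_def x(4)[symmetric] by blast
  then have "x \<in> ac_roots (pcompose f [:t, 1:])"
    by (simp add: mem_ac_roots_pcompose_translation)
  moreover have "lead_coeff (pcompose f [:t, 1:]) = 1"
    using f(1) by (subst lead_coeff_comp) auto
  ultimately have "pcompose f [:t, 1:] = f"
    using f frob_orbit_self irreducible_pcompose_translation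
    by (intro irreducible_monic_common_root_eq[of _ _ x]) auto
  then have "translation_invariant S f"
    using S_line[OF x(2,3)] translation_invariant_multiple
    unfolding translation_invariant_def by blast
  then have "f \<in> invariant_irreducibles S (CHAR('a) * e)"
    using f x(1) by (simp add: invariant_irreducibles_def)
  then show "x \<in> (\<Union>f\<in>invariant_irreducibles S (CHAR('a) * e). ac_roots f)"
    using f(4) frob_orbit_self by blast
next
  fix x assume "x \<in> (\<Union>f\<in>invariant_irreducibles S (CHAR('a) * e). ac_roots f)"
  then obtain f where f: "f \<in> invariant_irreducibles S (CHAR('a) * e)" "x \<in> ac_roots f" by blast
  have "S \<noteq> {0}" using card_S prime_gt_1_nat[OF CHAR_prime[where 'a = 'a]] by auto
  then obtain t where t: "t \<in> S" "t \<noteq> 0" using zero_in_S by blast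
  obtain e' i where *: "CHAR('a) * e = CHAR('a) * e'" "frob_order x = CHAR('a) * e"
    "\<not> CHAR('a) dvd i" "x ^ (CARD('a) ^ e') = x + to_ac (of_nat i * t)"
    using translation_invariant_root[OF f t] by metis
  have "of_nat i * t \<in> S - {0}"
    using *(3) t S_line[OF t] by (auto simp: of_nat_eq_0_iff_char_dvd)
  then have "to_ac (of_nat i * t) \<in> to_ac ` (S - {0})" by (rule imageI)
  moreover have "e' = e" using *(1) by simp
  ultimately show "x \<in> line_roots S e"
    using *(2,4) by (simp add: line_roots_def)
qed

text \<open>Each polynomial contributes a full Frobenius orbit of p e roots, and distinct monic
  irreducibles share no root.\<close>

lemma card_line_roots:
  "card (line_roots S e) = CHAR('a) * e * card (invariant_irreducibles S (CHAR('a) * e))"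
proof -
  let ?C = "invariant_irreducibles S (CHAR('a) * e)"
  have C: "irreducible f" "lead_coeff f = 1" "degree f = CHAR('a) * e" if "f \<in> ?C" for f
    using that by (auto simp: invariant_irreducibles_def)
  have card: "card (ac_roots f) = CHAR('a) * e" if "f \<in> ?C" for f
  proof -
    have "ac_roots f \<noteq> {}" using C(1)[OF that] by (rule ac_roots_nonempty)
    then obtain x where "x \<in> ac_roots f" by blast
    then show ?thesis
      using irreducible_degree_and_ac_roots[of f x] C[OF that] by (simp add: card_frob_orbit)
  qed
  have "card (line_roots S e) = (\<Sum>f\<in>?C. card (ac_roots f))"
    unfolding line_roots_eq_UN
  proof (rule card_UN_disjoint)
    show "\<forall>f\<in>?C. finite (ac_roots f)"
      by (auto intro!: finite_ac_roots dest: C(1))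
    show "\<forall>f\<in>?C. \<forall>g\<in>?C. f \<noteq> g \<longrightarrow> ac_roots f \<inter> ac_roots g = {}"
      using irreducible_monic_common_root_eq C by blast
  qed (rule finite_invariant_irreducibles)
  then show ?thesis using card by simp
qed

lemma finite_line_roots: "finite (line_roots S e)"
proof -
  have "finite (ac_roots f)" if "f \<in> invariant_irreducibles S n" for f n
    using that by (intro finite_ac_roots) (auto simp: invariant_irreducibles_def)
  then show ?thesis
    unfolding line_roots_eq_UN using finite_invariant_irreducibles by blast
qed

text \<open>A solution x of the equation for m has order p e with e dividing m, and d = m / e is
  prime to p. Conversely, iterating \<phi>^(m/d) d times adds d t, which is nonzero because p does
  not divide d.\<close>

lemma frob_translates_eq_UN_line_roots:
  assumes "m > 0"
  shows "{x. x ^ (CARD('a) ^ m) - x \<in> to_ac ` (S - {0})} =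
    (\<Union>d\<in>{d. d dvd m \<and> \<not> CHAR('a) dvd d}. line_roots S (m div d))"
proof (intro equalityI subsetI)
  fix x assume "x \<in> {x. x ^ (CARD('a) ^ m) - x \<in> to_ac ` (S - {0})}"
  then obtain t where t: "t \<in> S" "t \<noteq> 0" "x ^ (CARD('a) ^ m) = x + to_ac t"
    by (fastforce simp: algebra_simps)
  obtain e i where *: "frob_order x = CHAR('a) * e" "e dvd m" "\<not> CHAR('a) dvd m div e"
    "\<not> CHAR('a) dvd i" "x ^ (CARD('a) ^ e) = x + to_ac (of_nat i * t)"
    using frob_order_if_frob_translate[OF t(3,2)] by metis
  have "of_nat i * t \<in> S - {0}"
    using *(4) t S_line[OF t(1,2)] by (auto simp: of_nat_eq_0_iff_char_dvd)
  then have "to_ac (of_nat i * t) \<in> to_ac ` (S - {0})" by (rule imageI)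
  with * have "x \<in> line_roots S e"
    by (simp add: line_roots_def)
  moreover have "e = m div (m div e)"
    using *(2) assms by auto
  ultimately show "x \<in> (\<Union>d\<in>{d. d dvd m \<and> \<not> CHAR('a) dvd d}. line_roots S (m div d))"
    using *(2,3) by (intro UN_I[of "m div e"]) (auto simp: dvd_div_eq_mult)
next
  fix x assume "x \<in> (\<Union>d\<in>{d. d dvd m \<and> \<not> CHAR('a) dvd d}. line_roots S (m div d))"
  then obtain d t where d: "d dvd m" "\<not> CHAR('a) dvd d" "t \<in> S" "t \<noteq> 0"
    "x ^ (CARD('a) ^ (m div d)) = x + to_ac t"
    by (fastforce simp: line_roots_def algebra_simps)
  have "x ^ (CARD('a) ^ m) = x + to_ac (of_nat d * t)"
    using frob_translate_iterate[OF d(5), of d] d(1) by simp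
  moreover have "of_nat d * t \<in> S - {0}"
    using d(2-4) S_line[OF d(3,4)] by (auto simp: of_nat_eq_0_iff_char_dvd)
  then have "to_ac (of_nat d * t) \<in> to_ac ` (S - {0})" by (rule imageI)
  ultimately show "x \<in> {x. x ^ (CARD('a) ^ m) - x \<in> to_ac ` (S - {0})}"
    by simp
qed

text \<open>Double counting of the solutions of \<phi>^m x - x = t with t nonzero in S: sorted by
  the order of x on the left, and by t on the right, with q^m solutions for each of the p - 1 values
  of t.\<close>

lemma sum_card_line_roots:
  assumes "m > 0"
  shows "(\<Sum>d | d dvd m \<and> \<not> CHAR('a) dvd d. card (line_roots S (m div d))) = (CHAR('a) - 1) * CARD('a) ^ m"
proof -
  have "(\<Sum>d | d dvd m \<and> \<not> CHAR('a) dvd d. card (line_roots S (m div d))) =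
      card (\<Union>d\<in>{d. d dvd m \<and> \<not> CHAR('a) dvd d}. line_roots S (m div d))"
  proof (rule card_UN_disjoint[symmetric])
    show "finite {d. d dvd m \<and> \<not> CHAR('a) dvd d}"
      using finite_divisors_nat[OF assms] by (rule rev_finite_subset) auto
    \<comment> \<open>The order of x is p times m / d, so x determines d.\<close>
    have "d = d'" if "d dvd m" "d' dvd m" "x \<in> line_roots S (m div d)" "x \<in> line_roots S (m div d')" for d d' x
    proof -
      have "m div d = m div d'" using that by (auto simp: line_roots_def)
      then show ?thesis using that(1,2) assms by (metis dvd_div_eq_0_iff dvd_mult_div_cancel mult_cancel2 neq0_conv)
    qed
    then show "\<forall>d\<in>{d. d dvd m \<and> \<not> CHAR('a) dvd d}. \<forall>d'\<in>{d. d dvd m \<and> \<not> CHAR('a) dvd d}.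
        d \<noteq> d' \<longrightarrow> line_roots S (m div d) \<inter> line_roots S (m div d') = {}"
      by blast
  qed (use finite_line_roots in auto)
  also have "\<dots> = card {x. x ^ (CARD('a) ^ m) - x \<in> to_ac ` (S - {0})}"
    by (simp only: frob_translates_eq_UN_line_roots[OF assms])
  also have "{x. x ^ (CARD('a) ^ m) - x \<in> to_ac ` (S - {0})} =
      (\<Union>t\<in>S - {0}. {x. x ^ (CARD('a) ^ m) = x + to_ac t})"
    by (auto simp: algebra_simps)
  also have "card \<dots> = (\<Sum>t\<in>S - {0}. card {x :: 'a alg_closure. x ^ (CARD('a) ^ m) = x + to_ac t})"
  proof (rule card_UN_disjoint)
    have "finite {x :: 'a alg_closure. x ^ (CARD('a) ^ m) = x + to_ac t}" for t
      using card_pow_CARD_eq_translate[OF assms, of t] by (intro card_ge_0_finite) simp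
    then show "\<forall>t\<in>S - {0}. finite {x. x ^ (CARD('a) ^ m) = x + to_ac t}" by blast
  qed auto
  also have "\<dots> = (CHAR('a) - 1) * CARD('a) ^ m"
    using zero_in_S by (simp add: card_pow_CARD_eq_translate[OF assms] card_S)
  finally show ?thesis .
qed

end
end

section \<open>Lines over the prime field\<close>

lemma Fp_scale_of_nat: "Fp_scale (of_nat i) x = of_nat i * (x :: 'a :: finite_field)"
proof (induction i)
  case (Suc i)
  then show ?case
    by (simp add: Fp.scale_left_distrib distrib_right)
qed simp

text \<open>Residue classes have nonnegative representatives. This turns lines over the prime field
  into the sets of natural multiples used in the counting.\<close>

lemma range_Fp_scale: "range (\<lambda>c. Fp_scale c x) = range (\<lambda>i. of_nat i * (x :: 'a :: finite_field))"
proof (intro equalityI subsetI)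
  fix y assume "y \<in> range (\<lambda>c. Fp_scale c x)"
  then obtain c :: "'a ring_char mod_ring" where "y = of_int (to_int_mod_ring c) * x"
    unfolding Fp_scale_def by blast
  moreover have "to_int_mod_ring c \<ge> 0"
    by transfer simp
  ultimately have "y = of_nat (nat (to_int_mod_ring c)) * x"
    by simp
  then show "y \<in> range (\<lambda>i. of_nat i * x)" by blast
next
  fix y assume "y \<in> range (\<lambda>i. of_nat i * x)"
  then show "y \<in> range (\<lambda>c. Fp_scale c x)"
    by (auto simp flip: Fp_scale_of_nat)
qed

lemma Fp_dim_1_eq_range:
  fixes S :: "'a :: finite_field set"
  assumes "Fp.subspace S" "Fp.dim S = 1" "t \<in> S" "t \<noteq> 0"
  shows "S = range (\<lambda>c. Fp_scale c t)"
proof -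
  obtain B where B: "B \<subseteq> S" "Fp.independent B" "S \<subseteq> Fp.span B" "card B = Fp.dim S"
    using Fp.basis_exists by blast
  then obtain b where "B = {b}"
    using assms(2) card_1_singletonE by metis
  then have S: "S \<subseteq> range (\<lambda>c. Fp_scale c b)"
    using B(3) by (simp add: Fp.span_singleton)
  then obtain c where c: "t = Fp_scale c b" using assms(3) by blast
  with assms(4) have "c \<noteq> 0" by auto
  then have b: "b = Fp_scale (inverse c) t" by (simp add: c)
  show ?thesis
  proof
    show "S \<subseteq> range (\<lambda>c. Fp_scale c t)"
      using S unfolding b by auto
    show "range (\<lambda>c. Fp_scale c t) \<subseteq> S"
      using assms by (auto intro: Fp.subspace_scale)
  qed
qed

lemma Fp_dim_1_card:
  fixes S :: "'a :: finite_field set"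
  assumes "Fp.subspace S" "Fp.dim S = 1"
  shows "card S = CHAR('a)"
proof -
  have "\<not> S \<subseteq> {0}"
    using assms(2) Fp.dim_le_card[of S "{}"] by auto
  then obtain t where t: "t \<in> S" "t \<noteq> 0" by blast
  have "inj (\<lambda>c. Fp_scale c t)"
    using t(2) by (auto intro!: injI)
  then have "card (range (\<lambda>c. Fp_scale c t)) = CARD('a ring_char mod_ring)"
    by (simp add: card_image)
  then show ?thesis
    using Fp_dim_1_eq_range[OF assms t] by simp
qed

text \<open>For a fixed root x of f, the element \<phi>^e x - x with e = n / p is a multiple of
  every nonzero s in S, by a factor prime to p. Inverting that factor puts all of S into the span of
  a single t.\<close>

lemma Fp_dim_le_1_if_invariant_irreducible:
  fixes S :: "'a :: finite_field set"
  assumes "CARD('a) = CHAR('a) ^ k" and f: "f \<in> invariant_irreducibles S n"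
  shows "Fp.dim S \<le> 1"
proof (cases "S \<subseteq> {0}")
  case True
  then show ?thesis using Fp.dim_le_card[of S "{}"] by auto
next
  case False
  then obtain t where t: "t \<in> S" "t \<noteq> 0" by blast
  have "irreducible f" using f by (simp add: invariant_irreducibles_def)
  then obtain x where x: "x \<in> ac_roots f" using ac_roots_nonempty by blast
  note root = translation_invariant_root[OF assms(1) f x]
  obtain e i where e: "n = CHAR('a) * e" "x ^ (CARD('a) ^ e) = x + to_ac (of_nat i * t)"
    using root[OF t] by metis
  have "s \<in> Fp.span {t}" if "s \<in> S" for s
  proof (cases "s = 0")
    case False
    with that obtain e' i' where e': "n = CHAR('a) * e'" "\<not> CHAR('a) dvd i'"
      "x ^ (CARD('a) ^ e') = x + to_ac (of_nat i' * s)"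
      using root by metis
    have "e' = e" using e(1) e'(1) by simp
    then have "to_ac (of_nat i * t) = to_ac (of_nat i' * s)"
      using e(2) e'(3) by simp
    then have "of_nat i * t = of_nat i' * s"
      by (simp only: to_ac_eq_iff)
    then have *: "Fp_scale (of_nat i) t = Fp_scale (of_nat i') s"
      by (simp only: Fp_scale_of_nat)
    have "of_nat i' \<noteq> (0 :: 'a)"
      using e'(2) by (simp add: of_nat_eq_0_iff_char_dvd)
    then have "Fp_scale (of_nat i') s \<noteq> 0"
      using False by (simp add: Fp_scale_of_nat)
    then have "(of_nat i' :: 'a ring_char mod_ring) \<noteq> 0" by auto
    then have "s = Fp_scale (inverse (of_nat i')) (Fp_scale (of_nat i') s)" by simp
    also have "\<dots> \<in> Fp.span {t}"
      unfolding *[symmetric] by (intro Fp.span_scale Fp.span_base) simp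
    finally show ?thesis .
  qed (simp add: Fp.span_zero)
  then have "Fp.dim S \<le> card {t}"
    by (intro Fp.dim_le_card) auto
  then show ?thesis by simp
qed

theorem theorem2p7:
  fixes S :: "'a::finite_field set" and p k q r :: nat
  assumes "prime p" and "q = p ^ k" and "CARD('a) = q"
    and "Fp.subspace S" and "Fp.dim S = r" and "r > 0"
  shows "(r > 1 \<longrightarrow> (\<forall>n>0. card (invariant_irreducibles S n) = 0)) \<and>
         (r = 1 \<longrightarrow> (\<forall>n>0. \<not> p dvd n \<longrightarrow> card (invariant_irreducibles S n) = 0)) \<and>
         (r = 1 \<longrightarrow> (\<forall>n m. m > 0 \<longrightarrow> n = p * m \<longrightarrow>
            real (card (invariant_irreducibles S n)) =
              (real p - 1) / (real p * real m) *
              (\<Sum>d | d dvd m \<and> gcd d p = 1. real q ^ (m div d) * real_of_int (moebius_mu d))))"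
proof -
  have "CHAR('a) dvd p ^ k"
    using CHAR_dvd_CARD[where 'a = 'a] assms(2,3) by simp
  then have p: "CHAR('a) = p"
    using assms(1) CHAR_prime[where 'a = 'a] by (metis prime_dvd_power primes_dvd_imp_eq)
  then have CARD: "CARD('a) = CHAR('a) ^ k"
    using assms(2,3) by simp
  have "\<not> S \<subseteq> {0}"
    using assms(5,6) Fp.dim_le_card[of S "{}"] by auto
  then obtain t where t: "t \<in> S" "t \<noteq> 0" by blast
  have a: "card (invariant_irreducibles S n) = 0" if "r > 1" for n
    using Fp_dim_le_1_if_invariant_irreducible[OF CARD, of _ S n] that assms(5) by fastforce
  have b: "card (invariant_irreducibles S n) = 0" if "\<not> p dvd n" for n
  proof -
    have "f \<notin> invariant_irreducibles S n" for f
    proof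
      assume f: "f \<in> invariant_irreducibles S n"
      then have "irreducible f" by (simp add: invariant_irreducibles_def)
      then obtain x where x: "x \<in> ac_roots f" using ac_roots_nonempty by blast
      obtain e where "n = CHAR('a) * e"
        using translation_invariant_root[OF CARD f x t] by metis
      with that p show False by simp
    qed
    then have "invariant_irreducibles S n = {}" by blast
    then show ?thesis by simp
  qed
  have c: "real (card (invariant_irreducibles S (p * m))) =
      (real p - 1) / (real p * real m) *
      (\<Sum>d | d dvd m \<and> gcd d p = 1. real q ^ (m div d) * real_of_int (moebius_mu d))"
    if r: "r = 1" and m: "m > 0" for m
  proof -
    have dim: "Fp.dim S = 1" using assms(5) r by simp
    \<comment> \<open>These are the three properties of a line on which the counting lemmas
      rest.\<close>
    note S = Fp.subspace_0[OF assms(4)] Fp_dim_1_card[OF assms(4) dim]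
      Fp_dim_1_eq_range[OF assms(4) dim, unfolded range_Fp_scale]
    have "p > 0" using assms(1) prime_gt_0_nat by blast
    have sum: "(\<Sum>d | d dvd n \<and> \<not> p dvd d. real (card (line_roots S (n div d)))) =
        (real p - 1) * real q ^ n" if "n > 0" for n
    proof -
      have "(\<Sum>d | d dvd n \<and> \<not> p dvd d. card (line_roots S (n div d))) = (p - 1) * q ^ n"
        using sum_card_line_roots[OF CARD S that] assms(3) p by simp
      then have "real (\<Sum>d | d dvd n \<and> \<not> p dvd d. card (line_roots S (n div d))) = real ((p - 1) * q ^ n)"
        by (rule arg_cong)
      then show ?thesis using \<open>p > 0\<close> by (simp add: of_nat_diff)
    qed
    have "real p * real m * real (card (invariant_irreducibles S (p * m))) = real (card (line_roots S m))"
      using card_line_roots[OF CARD S, of m] p by simp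
    \<comment> \<open>Moebius inversion with G e the number of elements of
      \<open>line_roots S e\<close> and F n = (p - 1) q^n.\<close>
    also have "\<dots> = (\<Sum>d | d dvd m \<and> \<not> p dvd d. of_int (moebius_mu d) * ((real p - 1) * real q ^ (m div d)))"
      by (rule moebius_inversion_coprime_divisors[OF assms(1) m]) (simp add: sum)
    also have "{d. d dvd m \<and> \<not> p dvd d} = {d. d dvd m \<and> gcd d p = 1}"
      using assms(1) by (auto simp: gcd.commute[of _ p] prime_imp_coprime coprime_iff_gcd_eq_1[symmetric]
          dest: coprime_common_divisor_nat)
    finally have "real p * real m * real (card (invariant_irreducibles S (p * m))) =
        (real p - 1) * (\<Sum>d | d dvd m \<and> gcd d p = 1. real q ^ (m div d) * real_of_int (moebius_mu d))"
      unfolding sum_distrib_left by (simp only: mult_ac)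
    with \<open>p > 0\<close> m show ?thesis
      by (simp add: nonzero_eq_divide_eq mult_ac)
  qed
  show ?thesis using a b c by blast
qed

end
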